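(* Let $\Omega\subset\mathbb{R}^d$ be a periodic bumpy John domain and let $m\ge1$ be an integer. Then, for any $(w_{\rm poly},\pi_{\rm poly})\in\mathcal{S}^{\rm eff}_m(\Omega)$ and all $x\in\mathbb{R}^{d-1}$, $$w_{\rm poly}(x,0)=\sum_{\substack{|\alpha|+l\le m\\ \alpha\ge0,\ l\ge1}}\Phi^{\alpha,l}(x)\,\partial_x^\alpha\partial_y^lw_{\rm poly}(x,0),$$ where the sum is over $\alpha\in\mathbb{Z}_{\ge0}^{d-1}$ and integers $l\ge1$, and $\Phi^{\alpha,l}$ are the matrix-valued polynomials, determined by the boundary layers of $\Omega$, defined in the context.
   Context: Let $d\ge 2$. Points of $\mathbb{R}^d$ are written $(x,y)$ with $x\in\mathbb{R}^{d-1}$, $y\in\mathbb{R}$; $\mathbb{R}^d_+=\{y>0\}$; $\mathbf{e}_1,\dots,\mathbf{e}_d$ is the standard basis. $\mathbb{Z}_+=\{1,2,\dots\}$; $\alpha!=\alpha_1!\cdots\alpha_{d-1}!$. John domain: a bounded open set $D\subset\mathbb{R}^d$ is a (bounded) John domain with respect to $\tilde{\mathcal X}\in D$ and with constant $L\in(0,\infty)$ if for every $\mathcal Y\in D$ there is a Lipschitz map $\rho:[0,|\mathcal Y-\tilde{\mathcal X}|]\to D$ with Lipschitz constant $L$ such that $\rho(0)=\mathcal Y$, $\rho(|\mathcal Y-\tilde{\mathcal X}|)=\tilde{\mathcal X}$ and $\mathrm{dist}(\rho(t),\partial D)\ge t/L$ for all $t$. For $\Omega\subset\mathbb{R}^d$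 put $\Gamma=\partial\Omega$, $Q_R(x,y)=(x,y)+(-R,R)^d$, $B_{R,+}(x,0)=Q_R(x,0)\cap\Omega$, $B_{R,+}=B_{R,+}(0,0)$, and $\|f\|_{\underline{L}^2(E)}=\big(|E|^{-1}\int_E|f|^2\big)^{1/2}$. Periodic bumpy John domain: an open set $\Omega$ such that (1) $\mathbb{R}^d_+\subset\Omega\subset\{y>-1\}$; (2) there is a constant $L$ such that for every $\mathcal X\in\{(x,0)\}$ and every $R\ge1$ there is a bounded John domain $\Omega_R(\mathcal X)$ with respect to $\mathcal X+R\mathbf{e}_d$ and with constant $L$ satisfying $B_{R,+}(\mathcal X)\subset\Omega_R(\mathcal X)\subset B_{2R,+}(\mathcal X)$; (3) $\Omega+(2\pi z,0)=\Omega$ for all $z\in\mathbb{Z}^{d-1}$. Boundary layers: for every $\alpha\in\mathbb{Z}_{\ge0}^{d-1}$, $l\in\mathbb{Z}_+$, $i\in\{1,\dots,d\}$, fix once and for all a weak solution $(v^{\alpha,l}_{(i)},q^{\alpha,l}_{(i)})\in H^1_{\rm loc}(\overline\Omega)^d\times L^2_{\rm loc}(\overline\Omega)$ of $-\Delta v+\nabla q=0$, $\nabla\cdot v=0$ in $\Omega$, $v+x^\alpha y^l\mathbf{e}_i=0$ on $\Gamma$ (the boundary condition meaning $\chi(v+x^\alpha y^l\mathbf{e}_i)\in H^1_0(\Omega)^d$ for all $\chi\in C_0^\infty(\mathbb{R}^d)$) having the following properties (such solutions exist). For $r\ge1$, $\|v\|_{\underline{L}^2(B_{r,+})}\le Cr^{|\alpha|}$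 and $\|\nabla v\|_{\underline{L}^2(B_{r,+})}+\|q\|_{\underline{L}^2(B_{r,+})}\le Cr^{|\alpha|-1/2}$. Moreover $v=v_{\rm poly}+v_{\rm het}$, $q=q_{\rm poly}+q_{\rm het}$, where $v_{\rm poly},q_{\rm poly}$ are polynomials in $(x,y)$ with $|v_{\rm poly}|\le C(1+|x|+|y|)^{|\alpha|}$, $|\nabla v_{\rm poly}|+|q_{\rm poly}|\le C(1+|x|+|y|)^{|\alpha|-1}$, and $v_{\rm het},q_{\rm het}$ are linear combinations of products of a monomial in $x$ and a function $2\pi$-periodic in $x$ decaying exponentially as $y\to\infty$, with $|\nabla^jv_{\rm het}(x,y)|+|q_{\rm het}(x,y)|\le C(1+|x|)^{|\alpha|}e^{-y/2}$ for $y\ge4$, $j=0,1$. $\mathcal{S}_m(\mathbb{R}^d_+)$ is the space of pairs $(P,Q)$ of a polynomial vector field $P:\mathbb{R}^d\to\mathbb{R}^d$ of degree at most $m$ and a polynomial $Q$ of degree at most $m-1$ with $-\Delta P+\nabla Q=0$, $\nabla\cdot P=0$ in $\mathbb{R}^d_+$ and $P=0$ on $\partial\mathbb{R}^d_+$. Effective Stokes polynomials: $\mathcal{S}_m^{\rm eff}(\Omega)$ is the set of pairs $(w_{\rm poly},\pi_{\rm poly})$ with $$w_{\rm poly}=\sum_{|\alpha|+l\le m,\,l\ge1}\sum_{i=1}^dA_i^{\alpha,l}\big(x^\alpha y^l\mathbf{e}_i+(v^{\alpha,l}_{(i)})_{\rm poly}\big),\qquad \pi_{\rm poly}=Q+\sum_{|\alpha|+l\le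 m,\,l\ge1}\sum_{i=1}^dA_i^{\alpha,l}(q^{\alpha,l}_{(i)})_{\rm poly},$$ where $(P,Q)$ ranges over $\mathcal{S}_m(\mathbb{R}^d_+)$ and $P=\sum_{|\alpha|+l\le m,\,l\ge1}\sum_iA_i^{\alpha,l}x^\alpha y^l\mathbf{e}_i$. Matrices: let $W^{\alpha,l}_{(i)}=x^\alpha y^l\mathbf{e}_i+(v^{\alpha,l}_{(i)})_{\rm poly}$ and let $W^{\alpha,l}(x,y)$ be the $d\times d$ matrix with columns $W^{\alpha,l}_{(1)},\dots,W^{\alpha,l}_{(d)}$. Let $T_{(i)}=\lim_{y\to\infty}v^{0,1}_{(i)}(x,y)$ (a constant vector) and $\Phi^{0,1}=(T_{(1)},\dots,T_{(d-1)},0)\in\mathbb{R}^{d\times d}$ (columns). Recursively in $n=|\alpha|+l\ge2$, define $$\Phi^{\alpha,l}(x)=\frac1{\alpha!\,l!}\Big(W^{\alpha,l}(x,0)-\sum_{\substack{|\beta|+k\le n-1\\ \beta\ge0,\ k\ge1}}\Phi^{\beta,k}(x)\,\partial_x^\beta\partial_y^kW^{\alpha,l}(x,0)\Big).$$ *)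

theory Defs
  imports "HOL-Analysis.Analysis"
begin

text \<open>
  The dimension is d = CARD('n) + 1, which is at least 2 and otherwise arbitrary. Points of
  R^d have type \<^typ>\<open>real ^ ('n option)\<close>: the index \<^term>\<open>Some j\<close> belongs to the horizontal
  coordinate x_j, the index \<^term>\<open>None\<close> to the last coordinate y.
\<close>

definition pt :: "real ^ 'n \<Rightarrow> real \<Rightarrow> real ^ ('n::finite option)" where
  "pt x y = (\<chi> i. case i of None \<Rightarrow> y | Some j \<Rightarrow> x $ j)"

definition hor :: "real ^ ('n option) \<Rightarrow> real ^ ('n::finite)" where
  "hor X = (\<chi> j. X $ Some j)"

abbreviation ver :: "real ^ ('n::finite option) \<Rightarrow> real" where
  "ver X \<equiv> X $ None"

abbreviation halfspace :: "(real ^ ('n::finite option)) set" where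
  "halfspace \<equiv> {X. ver X > 0}"


section \<open>Multi-indices and polynomials\<close>

definition mi_size :: "('i::finite \<Rightarrow> nat) \<Rightarrow> nat" where
  "mi_size \<alpha> = (\<Sum>i\<in>UNIV. \<alpha> i)"

definition mi_fact :: "('i::finite \<Rightarrow> nat) \<Rightarrow> real" where
  "mi_fact \<alpha> = (\<Prod>i\<in>UNIV. fact (\<alpha> i))"

definition mi_pow :: "real ^ 'i \<Rightarrow> ('i::finite \<Rightarrow> nat) \<Rightarrow> real" where
  "mi_pow x \<alpha> = (\<Prod>i\<in>UNIV. (x $ i) ^ \<alpha> i)"

definition idx_le :: "nat \<Rightarrow> (('n::finite \<Rightarrow> nat) \<times> nat) set" where
  "idx_le m = {(\<alpha>, l). mi_size \<alpha> + l \<le> m \<and> 1 \<le> l}"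

lemma finite_mi_size_le: "finite {\<alpha> :: 'i::finite \<Rightarrow> nat. mi_size \<alpha> \<le> k}"
proof (rule finite_subset)
  show "{\<alpha> :: 'i \<Rightarrow> nat. mi_size \<alpha> \<le> k} \<subseteq> PiE UNIV (\<lambda>_. {..k})"
  proof
    fix \<alpha> :: "'i \<Rightarrow> nat"
    assume "\<alpha> \<in> {\<alpha>. mi_size \<alpha> \<le> k}"
    moreover have "\<alpha> i \<le> mi_size \<alpha>" for i
      unfolding mi_size_def by (rule member_le_sum) simp_all
    ultimately have "\<alpha> i \<le> k" for i
      using order_trans by blast
    then show "\<alpha> \<in> PiE UNIV (\<lambda>_. {..k})"
      by (simp add: PiE_def)
  qed
  show "finite (PiE (UNIV :: 'i set) (\<lambda>_. {..k}))"
    by (intro finite_PiE) auto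
qed

lemma finite_idx_le: "finite (idx_le m :: (('n::finite \<Rightarrow> nat) \<times> nat) set)"
proof (rule finite_subset)
  show "(idx_le m :: (('n \<Rightarrow> nat) \<times> nat) set) \<subseteq> {\<alpha>. mi_size \<alpha> \<le> m} \<times> {..m}"
    by (auto simp: idx_le_def)
  show "finite ({\<alpha> :: 'n \<Rightarrow> nat. mi_size \<alpha> \<le> m} \<times> {..m})"
    by (intro finite_cartesian_product finite_mi_size_le) auto
qed

definition poly_deg_le :: "nat \<Rightarrow> (real ^ 'i \<Rightarrow> 'b::real_vector) \<Rightarrow> bool" where
  "poly_deg_le k f \<longleftrightarrow>
     (\<exists>c. \<forall>X. f X = (\<Sum>\<gamma> | mi_size (\<gamma> :: 'i::finite \<Rightarrow> nat) \<le> k. mi_pow X \<gamma> *\<^sub>R c \<gamma>))"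

definition mono_field :: "('n \<Rightarrow> nat) \<Rightarrow> nat \<Rightarrow> 'n option \<Rightarrow> real ^ ('n option) \<Rightarrow> real ^ ('n::finite option)" where
  "mono_field \<alpha> l i X = (mi_pow (hor X) \<alpha> * ver X ^ l) *\<^sub>R axis i 1"


section \<open>Derivatives\<close>

definition pd :: "'i \<Rightarrow> (real ^ 'i \<Rightarrow> 'b::real_normed_vector) \<Rightarrow> (real ^ ('i::finite) \<Rightarrow> 'b)" where
  "pd j f = (\<lambda>X. frechet_derivative f (at X) (axis j 1))"

text \<open>
  The index type carries no order, so the order in which the partial derivatives are applied
  is that of an arbitrary enumeration of the indices; it is irrelevant for smooth functions,
  and below the operator is only applied to polynomials.
\<close>

definition index_list :: "('n::finite) list" where
  "index_list = (SOME js. distinct js \<and> set js = UNIV)"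

definition mderiv :: "('n \<Rightarrow> nat) \<Rightarrow> nat \<Rightarrow> (real ^ ('n option) \<Rightarrow> 'b::real_normed_vector)
    \<Rightarrow> (real ^ ('n::finite option) \<Rightarrow> 'b)" where
  "mderiv \<alpha> l f = foldr (\<lambda>j. pd (Some j) ^^ \<alpha> j) index_list ((pd None ^^ l) f)"

text \<open>
  Row \<open>j\<close> of the gradient is the derivative in direction \<open>j\<close>. The norm and the inner product
  on matrices provided by the library are those of Frobenius.
\<close>

definition grad :: "(real ^ 'i \<Rightarrow> 'b::real_normed_vector) \<Rightarrow> real ^ 'i \<Rightarrow> 'b ^ ('i::finite)" where
  "grad f X = (\<chi> j. pd j f X)"

definition dvg :: "(real ^ 'i \<Rightarrow> real ^ 'i) \<Rightarrow> real ^ ('i::finite) \<Rightarrow> real" where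
  "dvg f X = trace (grad f X)"

definition laplacian :: "(real ^ 'i \<Rightarrow> 'b::real_normed_vector) \<Rightarrow> real ^ ('i::finite) \<Rightarrow> 'b" where
  "laplacian f X = (\<Sum>j\<in>UNIV. pd j (pd j f) X)"

text \<open>C-infinity on an open set: all iterated partial derivatives are differentiable.\<close>

definition smooth_on :: "(real ^ 'i) set \<Rightarrow> (real ^ ('i::finite) \<Rightarrow> 'b::real_normed_vector) \<Rightarrow> bool" where
  "smooth_on S f \<longleftrightarrow> (\<forall>js. \<forall>X\<in>S. foldr pd js f differentiable (at X))"

definition test_fun :: "(real ^ 'i) set \<Rightarrow> (real ^ ('i::finite) \<Rightarrow> 'b::real_normed_vector) \<Rightarrow> bool" where
  "test_fun S f \<longleftrightarrow> smooth_on UNIV f \<and>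
     compact (closure {X. f X \<noteq> 0}) \<and> closure {X. f X \<noteq> 0} \<subseteq> S"


section \<open>Lebesgue and Sobolev spaces\<close>

definition L2 :: "(real ^ 'i) set \<Rightarrow> (real ^ ('i::finite) \<Rightarrow> 'b::euclidean_space) \<Rightarrow> bool" where
  "L2 E f \<longleftrightarrow> f \<in> borel_measurable (lebesgue_on E) \<and>
     integrable (lebesgue_on E) (\<lambda>X. (norm (f X))\<^sup>2)"

definition avg_L2_norm :: "(real ^ 'i) set \<Rightarrow> (real ^ ('i::finite) \<Rightarrow> 'b::euclidean_space) \<Rightarrow> real" where
  "avg_L2_norm E f = sqrt (integral\<^sup>L (lebesgue_on E) (\<lambda>X. (norm (f X))\<^sup>2) / measure lebesgue E)"

text \<open>Square integrability on bounded parts of \<open>\<Omega>\<close>, that is, local up to the boundary.\<close>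

definition L2_loc :: "(real ^ 'i) set \<Rightarrow> (real ^ ('i::finite) \<Rightarrow> 'b::euclidean_space) \<Rightarrow> bool" where
  "L2_loc \<Omega> f \<longleftrightarrow> (\<forall>R>0. L2 (\<Omega> \<inter> ball 0 R) f)"

definition weak_grad :: "(real ^ 'i) set \<Rightarrow> (real ^ 'i \<Rightarrow> 'b::euclidean_space)
    \<Rightarrow> (real ^ 'i \<Rightarrow> 'b ^ ('i::finite)) \<Rightarrow> bool" where
  "weak_grad \<Omega> u G \<longleftrightarrow> (\<forall>\<phi> :: real ^ 'i \<Rightarrow> real. test_fun \<Omega> \<phi> \<longrightarrow>
     (\<forall>j. integral\<^sup>L (lebesgue_on \<Omega>) (\<lambda>X. pd j \<phi> X *\<^sub>R u X)
        = - integral\<^sup>L (lebesgue_on \<Omega>) (\<lambda>X. \<phi> X *\<^sub>R (G X $ j))))"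

definition H1_loc :: "(real ^ 'i) set \<Rightarrow> (real ^ 'i \<Rightarrow> 'b::euclidean_space)
    \<Rightarrow> (real ^ 'i \<Rightarrow> 'b ^ ('i::finite)) \<Rightarrow> bool" where
  "H1_loc \<Omega> u G \<longleftrightarrow> L2_loc \<Omega> u \<and> L2_loc \<Omega> G \<and> weak_grad \<Omega> u G"

text \<open>The closure of the test functions in H^1.\<close>

definition H1_0 :: "(real ^ 'i) set \<Rightarrow> (real ^ ('i::finite) \<Rightarrow> 'b::euclidean_space) \<Rightarrow> bool" where
  "H1_0 \<Omega> u \<longleftrightarrow> (\<exists>G. L2 \<Omega> u \<and> L2 \<Omega> G \<and> weak_grad \<Omega> u G \<and>
     (\<exists>\<phi> :: nat \<Rightarrow> real ^ 'i \<Rightarrow> 'b. (\<forall>n. test_fun \<Omega> (\<phi> n)) \<and>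
       (\<lambda>n. integral\<^sup>L (lebesgue_on \<Omega>) (\<lambda>X. (norm (\<phi> n X - u X))\<^sup>2)
          + integral\<^sup>L (lebesgue_on \<Omega>) (\<lambda>X. (norm (grad (\<phi> n) X - G X))\<^sup>2)) \<longlonglongrightarrow> 0))"


section \<open>Periodic bumpy John domains\<close>

definition john_domain :: "'a::euclidean_space set \<Rightarrow> 'a \<Rightarrow> real \<Rightarrow> bool" where
  "john_domain D X0 L \<longleftrightarrow> bounded D \<and> open D \<and> X0 \<in> D \<and> 0 < L \<and>
     (\<forall>Y\<in>D. \<exists>\<rho> :: real \<Rightarrow> 'a.
        L-lipschitz_on {0..norm (Y - X0)} \<rho> \<and>
        \<rho> ` {0..norm (Y - X0)} \<subseteq> D \<and>
        \<rho> 0 = Y \<and> \<rho> (norm (Y - X0)) = X0 \<and>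
        (\<forall>t\<in>{0..norm (Y - X0)}. infdist (\<rho> t) (frontier D) \<ge> t / L))"

definition cube :: "real \<Rightarrow> real ^ 'i \<Rightarrow> (real ^ ('i::finite)) set" where
  "cube R X = {Z. \<forall>i. \<bar>Z $ i - X $ i\<bar> < R}"

definition Bplus :: "(real ^ 'i) set \<Rightarrow> real \<Rightarrow> real ^ 'i \<Rightarrow> (real ^ ('i::finite)) set" where
  "Bplus \<Omega> R X = cube R X \<inter> \<Omega>"

definition shift :: "('n \<Rightarrow> int) \<Rightarrow> real ^ ('n::finite option)" where
  "shift z = pt (\<chi> j. 2 * pi * of_int (z j)) 0"

definition periodic_bumpy_john_domain :: "(real ^ ('n::finite option)) set \<Rightarrow> bool" where
  "periodic_bumpy_john_domain \<Omega> \<longleftrightarrow>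
     open \<Omega> \<and>
     halfspace \<subseteq> \<Omega> \<and> \<Omega> \<subseteq> {X. ver X > -1} \<and>
     (\<exists>L>0. \<forall>x. \<forall>R\<ge>1. \<exists>D.
        john_domain D (pt x 0 + R *\<^sub>R axis None 1) L \<and>
        Bplus \<Omega> R (pt x 0) \<subseteq> D \<and> D \<subseteq> Bplus \<Omega> (2 * R) (pt x 0)) \<and>
     (\<forall>z. (\<lambda>X. X + shift z) ` \<Omega> = \<Omega>)"


section \<open>Boundary layers\<close>

definition weak_stokes :: "(real ^ 'i) set \<Rightarrow> (real ^ 'i \<Rightarrow> real ^ 'i ^ 'i)
    \<Rightarrow> (real ^ ('i::finite) \<Rightarrow> real) \<Rightarrow> bool" where
  "weak_stokes \<Omega> G q \<longleftrightarrow>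
     (\<forall>\<phi> :: real ^ 'i \<Rightarrow> real ^ 'i. test_fun \<Omega> \<phi> \<longrightarrow>
        integral\<^sup>L (lebesgue_on \<Omega>) (\<lambda>X. inner (G X) (grad \<phi> X) - q X * dvg \<phi> X) = 0) \<and>
     (AE X in lebesgue_on \<Omega>. trace (G X) = 0)"

definition het_form :: "(real ^ ('n::finite option)) set
    \<Rightarrow> (real ^ ('n option) \<Rightarrow> 'b::real_normed_vector) \<Rightarrow> bool" where
  "het_form \<Omega> f \<longleftrightarrow> (\<exists>(F :: ('n \<Rightarrow> nat) set) h. finite F \<and>
     (\<forall>X\<in>\<Omega>. f X = (\<Sum>\<beta>\<in>F. mi_pow (hor X) \<beta> *\<^sub>R h \<beta> X)) \<and>
     (\<forall>\<beta>\<in>F. \<forall>z. \<forall>X\<in>\<Omega>. h \<beta> (X + shift z) = h \<beta> X) \<and>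
     (\<forall>\<beta>\<in>F. \<exists>C c y0. c > 0 \<and>
        (\<forall>x y. y > 0 \<longrightarrow> y \<ge> y0 \<longrightarrow> norm (h \<beta> (pt x y)) \<le> C * exp (- c * y))))"

text \<open>
  \<open>(v, q)\<close> is a boundary layer for the data \<open>x^\<alpha> y^l e_i\<close>, with decomposition
  \<open>v = vp + vh\<close>, \<open>q = qp + qh\<close> into polynomial and exponentially decaying parts. Weak
  solutions of the Stokes system are smooth in the interior; \<open>v\<close> and \<open>q\<close> are the smooth
  representatives, so that point values, limits and classical derivatives make sense.
\<close>

definition boundary_layer :: "(real ^ ('n option)) set \<Rightarrow> ('n \<Rightarrow> nat) \<Rightarrow> nat \<Rightarrow> 'n option
    \<Rightarrow> (real ^ ('n option) \<Rightarrow> real ^ ('n option)) \<Rightarrow> (real ^ ('n option) \<Rightarrow> real)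
    \<Rightarrow> (real ^ ('n option) \<Rightarrow> real ^ ('n option)) \<Rightarrow> (real ^ ('n option) \<Rightarrow> real)
    \<Rightarrow> (real ^ ('n option) \<Rightarrow> real ^ ('n option)) \<Rightarrow> (real ^ ('n::finite option) \<Rightarrow> real)
    \<Rightarrow> bool" where
  "boundary_layer \<Omega> \<alpha> l i v q vp qp vh qh \<longleftrightarrow>
     smooth_on \<Omega> v \<and> smooth_on \<Omega> q \<and>
     (\<exists>G. H1_loc \<Omega> v G \<and> L2_loc \<Omega> q \<and> weak_stokes \<Omega> G q \<and>
        (\<exists>C. \<forall>r\<ge>1.
           avg_L2_norm (Bplus \<Omega> r 0) v \<le> C * r ^ mi_size \<alpha> \<and>
           avg_L2_norm (Bplus \<Omega> r 0) G + avg_L2_norm (Bplus \<Omega> r 0) q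
             \<le> C * r powr (real (mi_size \<alpha>) - 1 / 2))) \<and>
     (\<forall>\<eta> :: real ^ ('n option) \<Rightarrow> real. test_fun UNIV \<eta> \<longrightarrow>
        H1_0 \<Omega> (\<lambda>X. \<eta> X *\<^sub>R (v X + mono_field \<alpha> l i X))) \<and>
     (\<forall>X\<in>\<Omega>. v X = vp X + vh X \<and> q X = qp X + qh X) \<and>
     polynomial_function vp \<and> polynomial_function qp \<and>
     (\<exists>C. \<forall>x y.
        norm (vp (pt x y)) \<le> C * (1 + norm x + \<bar>y\<bar>) ^ mi_size \<alpha> \<and>
        norm (grad vp (pt x y)) + \<bar>qp (pt x y)\<bar>
          \<le> C * (1 + norm x + \<bar>y\<bar>) powr (real (mi_size \<alpha>) - 1)) \<and>
     het_form \<Omega> vh \<and> het_form \<Omega> qh \<and>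
     (\<exists>C. \<forall>x. \<forall>y\<ge>4.
        norm (vh (pt x y)) + \<bar>qh (pt x y)\<bar>
          \<le> C * (1 + norm x) ^ mi_size \<alpha> * exp (- y / 2) \<and>
        norm (grad vh (pt x y)) + \<bar>qh (pt x y)\<bar>
          \<le> C * (1 + norm x) ^ mi_size \<alpha> * exp (- y / 2))"


section \<open>Stokes polynomials\<close>

definition stokes_poly :: "nat \<Rightarrow> ((real ^ ('n option) \<Rightarrow> real ^ ('n option)) \<times>
    (real ^ ('n::finite option) \<Rightarrow> real)) set" where
  "stokes_poly m = {(P, Q). poly_deg_le m P \<and> poly_deg_le (m - 1) Q \<and>
     (\<forall>X\<in>halfspace. - laplacian P X + grad Q X = 0 \<and> dvg P X = 0) \<and>
     (\<forall>x. P (pt x 0) = 0)}"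

type_synonym ('n, 'c) layers = "('n \<Rightarrow> nat) \<Rightarrow> nat \<Rightarrow> 'n option \<Rightarrow> real ^ ('n option) \<Rightarrow> 'c"

definition Wcol :: "('n, real ^ ('n option)) layers \<Rightarrow> ('n::finite, real ^ ('n option)) layers" where
  "Wcol vp \<alpha> l i X = mono_field \<alpha> l i X + vp \<alpha> l i X"

definition stokes_eff :: "('n, real ^ ('n option)) layers \<Rightarrow> ('n, real) layers \<Rightarrow> nat
    \<Rightarrow> ((real ^ ('n option) \<Rightarrow> real ^ ('n option)) \<times> (real ^ ('n::finite option) \<Rightarrow> real)) set" where
  "stokes_eff vp qp m = {(w, \<pi>). \<exists>P Q A. (P, Q) \<in> stokes_poly m \<and>
     P = (\<lambda>X. \<Sum>(\<alpha>, l)\<in>idx_le m. \<Sum>i\<in>UNIV. A \<alpha> l i *\<^sub>R mono_field \<alpha> l i X) \<and>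
     w = (\<lambda>X. \<Sum>(\<alpha>, l)\<in>idx_le m. \<Sum>i\<in>UNIV. A \<alpha> l i *\<^sub>R Wcol vp \<alpha> l i X) \<and>
     \<pi> = (\<lambda>X. Q X + (\<Sum>(\<alpha>, l)\<in>idx_le m. \<Sum>i\<in>UNIV. A \<alpha> l i * qp \<alpha> l i X))}"


section \<open>The matrices in the effective boundary condition\<close>

text \<open>Matrices are indexed as \<open>A $ row $ column\<close>.\<close>

definition Wmat :: "('n, real ^ ('n option)) layers \<Rightarrow> ('n \<Rightarrow> nat) \<Rightarrow> nat
    \<Rightarrow> real ^ ('n option) \<Rightarrow> real ^ ('n::finite option) ^ ('n option)" where
  "Wmat vp \<alpha> l X = (\<chi> r c. Wcol vp \<alpha> l c X $ r)"

definition Tvec :: "('n, real ^ ('n option)) layers \<Rightarrow> 'n option \<Rightarrow> real ^ ('n::finite option)" where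
  "Tvec v i = (THE T. \<forall>x. ((\<lambda>y. v (\<lambda>_. 0) 1 i (pt x y)) \<longlongrightarrow> T) at_top)"

definition Phi01 :: "('n, real ^ ('n option)) layers \<Rightarrow> real ^ ('n::finite option) ^ ('n option)" where
  "Phi01 v = (\<chi> r c. if c = None then 0 else Tvec v c $ r)"

text \<open>
  The matrices are only meant for \<open>l \<ge> 1\<close>, and the value for \<open>l = 0\<close> is never used. If
  \<open>l \<ge> 1\<close> and \<open>|\<alpha>| + l \<le> 1\<close> then \<open>\<alpha> = 0\<close> and \<open>l = 1\<close>.
\<close>

function Phi :: "('n, real ^ ('n option)) layers \<Rightarrow> ('n, real ^ ('n option)) layers
    \<Rightarrow> ('n \<Rightarrow> nat) \<Rightarrow> nat \<Rightarrow> real ^ 'n \<Rightarrow> real ^ ('n::finite option) ^ ('n option)" where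
  "Phi v vp \<alpha> l x =
     (if l = 0 then 0
      else if mi_size \<alpha> + l \<le> 1 then Phi01 v
      else (1 / (mi_fact \<alpha> * fact l)) *\<^sub>R
        (Wmat vp \<alpha> l (pt x 0)
         - (\<Sum>(\<beta>, k)\<in>idx_le (mi_size \<alpha> + l - 1).
              Phi v vp \<beta> k x ** mderiv \<beta> k (Wmat vp \<alpha> l) (pt x 0))))"
  by pat_completeness auto
termination
  by (relation "Wellfounded.measure (\<lambda>(v, vp, \<alpha>, l, x). mi_size \<alpha> + l)") (auto simp: idx_le_def)

declare Phi.simps [simp del]

end

theory Submission
  imports Defs
begin

text \<open>
  Both sides of the effective boundary condition are linear in \<open>w\<close>, so it is enough to verify it
  for each field \<open>W = x^\<alpha> y^l e_i + vp\<close> whose coefficient in \<open>w\<close> does not vanish. Put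
  \<open>n = |\<alpha>| + l\<close>. The polynomial part \<open>vp\<close> of the boundary layer grows at most like the power
  \<open>|\<alpha>| < n\<close>, hence has degree at most \<open>|\<alpha>|\<close> (\<open>poly_field_if_growth_le\<close>), and every derivative
  of order at least \<open>n\<close> kills it. Of the derivatives of \<open>x^\<alpha> y^l\<close> of order at least \<open>n\<close>, only the one
  of type \<open>(\<alpha>, l)\<close> survives, and it is the constant \<open>\<alpha>! l!\<close> (\<open>mderiv_Wcol_top\<close>). In the sum over
  all \<open>(\<beta>, k)\<close> there remain the terms of order less than \<open>n\<close> and the single term
  \<open>\<alpha>! l! \<Phi>^{\<alpha>,l} e_i\<close>. For \<open>n \<ge> 2\<close> the recursion defines \<open>\<Phi>^{\<alpha>,l}\<close> so that they add up to
  \<open>W(x,0)\<close> (\<open>Wcol_eq_sum_Phi\<close>).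

  For \<open>n = 1\<close>, that is \<open>\<alpha> = 0\<close> and \<open>l = 1\<close>, the monomial vanishes at \<open>y = 0\<close> and \<open>vp\<close> is a
  constant, equal to the limit \<open>T_i\<close> of the boundary layer as \<open>y \<rightarrow> \<infinity>\<close> (\<open>Tvec_eq\<close>). This is
  column \<open>i\<close> of \<open>\<Phi>^{0,1}\<close> when \<open>i\<close> is horizontal. The vertical column of \<open>\<Phi>^{0,1}\<close> is zero by
  definition, but the coefficient of \<open>y e_d\<close> in \<open>P\<close> is zero as well, because it is the value of
  \<open>\<nabla>\<cdot>P\<close> at the origin (\<open>solenoidal_coeff_eq_0\<close>).
\<close>


section \<open>Iterated partial derivatives as words\<close>

text \<open>
  Joining \<open>(\<alpha>, l)\<close> into one multi-index over all \<open>d\<close> coordinates treats the horizontal and the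
  vertical variables alike.
\<close>

definition joint_mi :: "('n \<Rightarrow> nat) \<Rightarrow> nat \<Rightarrow> 'n option \<Rightarrow> nat" where
  "joint_mi \<alpha> l i = (case i of None \<Rightarrow> l | Some j \<Rightarrow> \<alpha> j)"

lemma joint_mi_simps [simp]: "joint_mi \<alpha> l None = l" "joint_mi \<alpha> l (Some j) = \<alpha> j"
  by (simp_all add: joint_mi_def)

lemma joint_mi_eq_iff: "joint_mi \<alpha> l = joint_mi \<beta> k \<longleftrightarrow> \<alpha> = \<beta> \<and> l = k"
  by (metis ext joint_mi_simps)

lemma mi_size_joint_mi: "mi_size (joint_mi \<alpha> l) = mi_size \<alpha> + l"
  by (simp add: mi_size_def UNIV_option_conv sum.reindex)

lemma mi_fact_joint_mi: "mi_fact (joint_mi \<alpha> l) = mi_fact \<alpha> * fact l"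
  by (simp add: mi_fact_def UNIV_option_conv prod.reindex)

lemma mono_field_eq_mi_pow:
  "mono_field \<alpha> l i = (\<lambda>X. mi_pow X (joint_mi \<alpha> l) *\<^sub>R axis i 1)"
  by (simp add: fun_eq_iff mono_field_def mi_pow_def hor_def UNIV_option_conv prod.reindex)

text \<open>
  Writing a mixed derivative as a word in the partial derivatives reduces every statement about it
  to an induction on the letters. By \<open>count_list_deriv_word\<close> the order of the letters, which depends
  on an arbitrary enumeration of the coordinates, can be forgotten.
\<close>

definition deriv_word :: "('n::finite \<Rightarrow> nat) \<Rightarrow> nat \<Rightarrow> 'n option list" where
  "deriv_word \<beta> k =
     concat (map (\<lambda>j. replicate (\<beta> j) (Some j)) index_list) @ replicate k None"

lemma mderiv_eq_foldr_pd: "mderiv \<beta> k f = foldr pd (deriv_word \<beta> k) f"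
proof -
  have "foldr pd (concat (map (\<lambda>j. replicate (\<beta> j) (Some j)) js)) g
      = foldr (\<lambda>j. pd (Some j) ^^ \<beta> j) js g" for js and g :: "real ^ 'a option \<Rightarrow> 'b"
    by (induction js) simp_all
  then show ?thesis
    by (simp add: mderiv_def deriv_word_def)
qed

lemma index_list: "distinct (index_list :: 'n::finite list)" "set (index_list :: 'n list) = UNIV"
proof -
  have "\<exists>js :: 'n list. distinct js \<and> set js = UNIV"
    using finite_distinct_list[of "UNIV :: 'n set"] by auto
  then have "distinct (index_list :: 'n list) \<and> set (index_list :: 'n list) = UNIV"
    unfolding index_list_def by (rule someI_ex)
  then show "distinct (index_list :: 'n list)" "set (index_list :: 'n list) = UNIV"
    by auto
qed

lemma count_list_deriv_word: "count_list (deriv_word \<beta> k) = joint_mi \<beta> k"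
proof
  fix i :: "'a option"
  have rep: "count_list (replicate n (a :: 'a option)) b = (if a = b then n else 0)" for n a b
    by (induction n) auto
  have none: "count_list (concat (map (\<lambda>j. replicate (\<beta> j) (Some j)) js)) None = 0" for js
    by (induction js) (simp_all add: rep)
  have some: "distinct js \<Longrightarrow> count_list (concat (map (\<lambda>j. replicate (\<beta> j) (Some j)) js)) (Some a)
      = (if a \<in> set js then \<beta> a else 0)" for js a
    by (induction js) (auto simp: rep)
  show "count_list (deriv_word \<beta> k) i = joint_mi \<beta> k i"
    by (cases i) (simp_all add: deriv_word_def rep none some index_list)
qed

lemma mi_size_count_list: "mi_size (count_list js) = length js"
  for js :: "'i::finite list"
  by (simp add: mi_size_def sum_count_set)

lemma length_deriv_word: "length (deriv_word \<beta> k) = mi_size \<beta> + k"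
  using mi_size_count_list[of "deriv_word \<beta> k"]
  by (simp add: count_list_deriv_word mi_size_joint_mi)


section \<open>Differentiating monomials\<close>


lemma mi_pow_monomial_has_derivative:
  fixes X :: "real ^ 'i::finite" and c :: "'b::real_normed_vector"
  shows "((\<lambda>X. mi_pow X \<gamma> *\<^sub>R c) has_derivative
    (\<lambda>Y. (\<Sum>i\<in>UNIV. (real (\<gamma> i) * (Y $ i) * (X $ i) ^ (\<gamma> i - 1)) *
       (\<Prod>j\<in>UNIV - {i}. (X $ j) ^ \<gamma> j)) *\<^sub>R c)) (at X)"
proof -
  have "((\<lambda>X. (X $ i) ^ \<gamma> i) has_derivative (\<lambda>Y. real (\<gamma> i) * (Y $ i) * (X $ i) ^ (\<gamma> i - 1))) (at X)"
    for i
    by (rule has_derivative_power) (auto intro!: bounded_linear_imp_has_derivative bounded_linear_intros)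
  then have "((\<lambda>X. mi_pow X \<gamma>) has_derivative
    (\<lambda>Y. \<Sum>i\<in>UNIV. (real (\<gamma> i) * (Y $ i) * (X $ i) ^ (\<gamma> i - 1)) *
       (\<Prod>j\<in>UNIV - {i}. (X $ j) ^ \<gamma> j))) (at X)"
    unfolding mi_pow_def by (rule has_derivative_prod)
  then show ?thesis
    by (rule has_derivative_scaleR_left)
qed

lemma pd_monomial:
  fixes c :: "'b::real_normed_vector"
  shows "pd j (\<lambda>X :: real ^ 'i::finite. mi_pow X \<gamma> *\<^sub>R c)
    = (\<lambda>X. mi_pow X (\<gamma>(j := \<gamma> j - 1)) *\<^sub>R (real (\<gamma> j) *\<^sub>R c))"
proof
  fix X :: "real ^ 'i"
  have "(\<Sum>i\<in>UNIV. (real (\<gamma> i) * (axis j 1 $ i) * (X $ i) ^ (\<gamma> i - 1)) *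
       (\<Prod>j\<in>UNIV - {i}. (X $ j) ^ \<gamma> j))
    = (\<Sum>i\<in>UNIV. if i = j then real (\<gamma> j) * (X $ j) ^ (\<gamma> j - 1) *
       (\<Prod>i\<in>UNIV - {j}. (X $ i) ^ \<gamma> i) else 0)"
    by (rule sum.cong) (auto simp: axis_def)
  also have "\<dots> = real (\<gamma> j) * ((X $ j) ^ (\<gamma> j - 1) * (\<Prod>i\<in>UNIV - {j}. (X $ i) ^ \<gamma> i))"
    by simp
  also have "(X $ j) ^ (\<gamma> j - 1) * (\<Prod>i\<in>UNIV - {j}. (X $ i) ^ \<gamma> i) = mi_pow X (\<gamma>(j := \<gamma> j - 1))"
    unfolding mi_pow_def by (subst prod.remove[of UNIV j]) (auto intro!: prod.cong)
  finally show "pd j (\<lambda>X. mi_pow X \<gamma> *\<^sub>R c) X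
    = mi_pow X (\<gamma>(j := \<gamma> j - 1)) *\<^sub>R (real (\<gamma> j) *\<^sub>R c)"
    unfolding pd_def frechet_derivative_at[OF mi_pow_monomial_has_derivative, symmetric]
    by simp
qed

text \<open>
  Each letter \<open>i\<close> lowers the exponent of coordinate \<open>i\<close> and multiplies by its current value, which
  gives falling factorials. Truncated subtraction is harmless: when a letter is used more often
  than the exponent permits, the product contains the factor zero.
\<close>

lemma foldr_pd_monomial:
  fixes c :: "'b::real_normed_vector"
  shows "foldr pd js (\<lambda>X :: real ^ 'i::finite. mi_pow X \<gamma> *\<^sub>R c)
    = (\<lambda>X. mi_pow X (\<lambda>i. \<gamma> i - count_list js i) *\<^sub>R
        ((\<Prod>i\<in>UNIV. \<Prod>r<count_list js i. real (\<gamma> i - r)) *\<^sub>R c))"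
proof (induction js)
  case Nil
  then show ?case by simp
next
  case (Cons j js)
  have 1: "(\<lambda>i. \<gamma> i - count_list js i)(j := \<gamma> j - count_list js j - 1)
      = (\<lambda>i. \<gamma> i - count_list (j # js) i)"
    by auto
  have 2: "real (\<gamma> j - count_list js j) * (\<Prod>i\<in>UNIV. \<Prod>r<count_list js i. real (\<gamma> i - r))
      = (\<Prod>i\<in>UNIV. \<Prod>r<count_list (j # js) i. real (\<gamma> i - r))"
    by (subst (1 2) prod.remove[of UNIV j]) (auto intro!: prod.cong)
  have "foldr pd (j # js) (\<lambda>X. mi_pow X \<gamma> *\<^sub>R c)
      = (\<lambda>X. mi_pow X (\<lambda>i. \<gamma> i - count_list (j # js) i) *\<^sub>R
          (real (\<gamma> j - count_list js j) *\<^sub>R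
            ((\<Prod>i\<in>UNIV. \<Prod>r<count_list js i. real (\<gamma> i - r)) *\<^sub>R c)))"
    by (simp only: foldr_Cons comp_apply Cons.IH pd_monomial 1)
  then show ?case
    by (simp only: scaleR_scaleR[of "real _"] 2)
qed

text \<open>
  A word at least as long as the degree either uses each letter exactly as often as the exponents
  prescribe, or uses some letter too often.
\<close>

lemma foldr_pd_monomial_eq_0:
  fixes c :: "'b::real_normed_vector"
  assumes "mi_size \<gamma> \<le> length js" "\<gamma> \<noteq> count_list js"
  shows "foldr pd js (\<lambda>X :: real ^ 'i::finite. mi_pow X \<gamma> *\<^sub>R c) = (\<lambda>X. 0)"
proof -
  \<comment> \<open>otherwise the counts lie below \<open>\<gamma>\<close>, strictly somewhere, and the word is too short\<close>
  obtain i where i: "\<gamma> i < count_list js i"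
  proof (rule ccontr)
    assume "\<not> thesis"
    then have le: "count_list js i \<le> \<gamma> i" for i
      using that not_less by blast
    obtain i where "count_list js i < \<gamma> i"
      using assms(2) le by (metis ext le_neq_implies_less)
    then have "mi_size (count_list js) < mi_size \<gamma>"
      unfolding mi_size_def using le by (intro sum_strict_mono_ex1) auto
    then show False
      using assms(1) by (simp add: mi_size_count_list)
  qed
  then have "(\<Prod>r<count_list js i. real (\<gamma> i - r)) = 0"
    by (intro prod_zero bexI[of _ "\<gamma> i"]) auto
  then have "(\<Prod>i\<in>UNIV. \<Prod>r<count_list js i. real (\<gamma> i - r)) = 0"
    by (intro prod_zero bexI[of _ i]) auto
  then show ?thesis
    by (simp only: foldr_pd_monomial scaleR_zero_left scaleR_zero_right)
qed

lemma foldr_pd_monomial_same: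
  fixes c :: "'b::real_normed_vector"
  assumes "\<gamma> = count_list js"
  shows "foldr pd js (\<lambda>X :: real ^ 'i::finite. mi_pow X \<gamma> *\<^sub>R c) = (\<lambda>X. mi_fact \<gamma> *\<^sub>R c)"
proof -
  have "(\<Prod>r<n. real (n - r)) = fact n" for n
    by (simp add: fact_prod_rev lessThan_atLeast0)
  then show ?thesis
    unfolding foldr_pd_monomial assms[symmetric] by (simp add: mi_pow_def mi_fact_def)
qed


section \<open>Linearity of iterated partial derivatives\<close>

lemma smooth_on_UNIV_D:
  "smooth_on UNIV f \<Longrightarrow> foldr pd js f differentiable (at X)"
  by (simp add: smooth_on_def)

lemma pd_add:
  assumes "f differentiable (at X)" "g differentiable (at X)"
  shows "pd j (\<lambda>X. f X + g X) X = pd j f X + pd j g X"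
proof -
  have "((\<lambda>X. f X + g X) has_derivative
    (\<lambda>h. frechet_derivative f (at X) h + frechet_derivative g (at X) h)) (at X)"
    using assms by (intro has_derivative_add) (simp_all add: frechet_derivative_works[symmetric])
  from fun_cong[OF frechet_derivative_at[OF this], of "axis j 1"] show ?thesis
    unfolding pd_def by (rule sym)
qed

lemma pd_bounded_linear:
  assumes "bounded_linear T" "f differentiable (at X)"
  shows "pd j (\<lambda>X. T (f X)) X = T (pd j f X)"
proof -
  have "((\<lambda>X. T (f X)) has_derivative (\<lambda>h. T (frechet_derivative f (at X) h))) (at X)"
    using assms(2) unfolding frechet_derivative_works
    by (rule bounded_linear.has_derivative[OF assms(1)])
  from fun_cong[OF frechet_derivative_at[OF this], of "axis j 1"] show ?thesis
    unfolding pd_def by (rule sym)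
qed

lemma foldr_pd_add:
  assumes "smooth_on UNIV f" "smooth_on UNIV g"
  shows "foldr pd js (\<lambda>X. f X + g X) = (\<lambda>X. foldr pd js f X + foldr pd js g X)"
proof (induction js)
  case (Cons j js)
  show ?case
    by (rule ext) (simp add: Cons.IH pd_add smooth_on_UNIV_D assms)
qed simp

lemma foldr_pd_bounded_linear:
  assumes "smooth_on UNIV f" "bounded_linear T"
  shows "foldr pd js (\<lambda>X. T (f X)) = (\<lambda>X. T (foldr pd js f X))"
proof (induction js)
  case (Cons j js)
  show ?case
    by (rule ext) (simp add: Cons.IH pd_bounded_linear[OF assms(2)] smooth_on_UNIV_D assms)
qed simp

lemma smooth_on_UNIV_monomial:
  "smooth_on UNIV (\<lambda>X :: real ^ 'i::finite. mi_pow X \<gamma> *\<^sub>R c)"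
  unfolding smooth_on_def foldr_pd_monomial
  using mi_pow_monomial_has_derivative by (blast intro: differentiableI)

lemma smooth_on_UNIV_add:
  assumes "smooth_on UNIV f" "smooth_on UNIV g"
  shows "smooth_on UNIV (\<lambda>X. f X + g X)"
  using assms unfolding smooth_on_def foldr_pd_add[OF assms] by (auto intro: differentiable_add)

lemma smooth_on_UNIV_bounded_linear:
  assumes "smooth_on UNIV f" "bounded_linear T"
  shows "smooth_on UNIV (\<lambda>X. T (f X))"
proof -
  have "(\<lambda>X. T (g X)) differentiable at X" if "g differentiable at X" for g :: "real ^ 'a \<Rightarrow> 'b" and X
    using that bounded_linear.has_derivative[OF assms(2)] unfolding differentiable_def by blast
  then show ?thesis
    using assms(1) unfolding smooth_on_def foldr_pd_bounded_linear[OF assms] by auto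
qed

lemma smooth_on_UNIV_zero: "smooth_on UNIV (\<lambda>X :: real ^ 'i::finite. 0 :: 'b::real_normed_vector)"
  using smooth_on_UNIV_monomial[of "\<lambda>_. 0" "0 :: 'b"] by simp

lemma foldr_pd_zero: "foldr pd js (\<lambda>X :: real ^ 'i::finite. 0 :: 'b::real_normed_vector) = (\<lambda>X. 0)"
  using foldr_pd_monomial[of js "\<lambda>_. 0" "0 :: 'b"] by simp

lemma smooth_on_UNIV_sum:
  assumes "\<And>a. a \<in> S \<Longrightarrow> smooth_on UNIV (f a)"
  shows "smooth_on UNIV (\<lambda>X. \<Sum>a\<in>S. f a X)"
  using assms
  by (induction S rule: infinite_finite_induct)
    (simp_all add: smooth_on_UNIV_zero smooth_on_UNIV_add)

lemma foldr_pd_sum: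
  assumes "\<And>a. a \<in> S \<Longrightarrow> smooth_on UNIV (f a)"
  shows "foldr pd js (\<lambda>X. \<Sum>a\<in>S. f a X) = (\<lambda>X. \<Sum>a\<in>S. foldr pd js (f a) X)"
  using assms
  by (induction S rule: infinite_finite_induct)
    (simp_all add: foldr_pd_zero foldr_pd_add smooth_on_UNIV_sum)


section \<open>The degree of a polynomial field of bounded growth\<close>

text \<open>
  The linear span of the monomials of size at most \<open>k\<close>. The inductive form lets additive
  properties be checked on monomials alone, with values in any normed space.
\<close>

inductive poly_field :: "nat \<Rightarrow> (real ^ 'i::finite \<Rightarrow> 'b::real_normed_vector) \<Rightarrow> bool"
  for k where
  zero: "poly_field k (\<lambda>X. 0)"
| monomial: "mi_size \<gamma> \<le> k \<Longrightarrow> poly_field k (\<lambda>X. mi_pow X \<gamma> *\<^sub>R c)"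
| add: "poly_field k f \<Longrightarrow> poly_field k g \<Longrightarrow> poly_field k (\<lambda>X. f X + g X)"

lemma poly_field_sum:
  assumes "\<And>a. a \<in> S \<Longrightarrow> poly_field k (f a)"
  shows "poly_field k (\<lambda>X. \<Sum>a\<in>S. f a X)"
  using assms
  by (induction S rule: infinite_finite_induct) (simp_all add: poly_field.intros)

lemma poly_field_mono: "poly_field k f \<Longrightarrow> k \<le> l \<Longrightarrow> poly_field l f"
  by (induction rule: poly_field.induct) (simp_all add: poly_field.intros)

lemma poly_field_linear:
  assumes "poly_field k f" "linear T"
  shows "poly_field k (\<lambda>X. T (f X))"
  using assms(1)
  by (induction rule: poly_field.induct)
    (simp_all add: poly_field.intros linear_0[OF assms(2)] linear_add[OF assms(2)] linear_scale[OF assms(2)])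

lemma poly_field_mult:
  fixes f g :: "real ^ 'i::finite \<Rightarrow> real"
  assumes "poly_field k f" "poly_field l g"
  shows "poly_field (k + l) (\<lambda>X. f X * g X)"
  using assms(1)
proof (induction rule: poly_field.induct)
  case (monomial \<gamma> c)
  show ?case
    using assms(2)
  proof (induction rule: poly_field.induct)
    case (monomial \<delta> d)
    have "mi_pow X \<gamma> *\<^sub>R c * mi_pow X \<delta> *\<^sub>R d = mi_pow X (\<lambda>i. \<gamma> i + \<delta> i) *\<^sub>R (c * d)" for X
      by (simp add: mi_pow_def power_add prod.distrib)
    moreover have "mi_size (\<lambda>i. \<gamma> i + \<delta> i) \<le> k + l"
      using monomial \<open>mi_size \<gamma> \<le> k\<close> by (simp add: mi_size_def sum.distrib)
    ultimately show ?case
      by (simp only: poly_field.monomial)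
  qed (simp_all only: mult_zero_right ring_distribs poly_field.intros)
qed (simp_all only: mult_zero_left ring_distribs poly_field.intros)

lemma smooth_on_UNIV_poly_field: "poly_field k f \<Longrightarrow> smooth_on UNIV f"
  by (induction rule: poly_field.induct)
    (simp_all add: smooth_on_UNIV_zero smooth_on_UNIV_monomial smooth_on_UNIV_add)

lemma foldr_pd_poly_field_eq_0:
  assumes "poly_field k f" "k < length js"
  shows "foldr pd js f = (\<lambda>X. 0)"
  using assms(1)
proof (induction rule: poly_field.induct)
  case zero
  then show ?case by (rule foldr_pd_zero)
next
  case (monomial \<gamma> c)
  then show ?case
    using assms(2) mi_size_count_list[of js] by (intro foldr_pd_monomial_eq_0) auto
next
  case (add f g)
  then show ?case
    by (simp add: foldr_pd_add smooth_on_UNIV_poly_field)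
qed

lemma poly_field_0_constant:
  assumes "poly_field 0 f"
  shows "f X = f Y"
  using assms
  by (induction rule: poly_field.induct) (auto simp: mi_size_def mi_pow_def)

text \<open>
  Some degree bound always exists; the sharp one is extracted from the growth below.
\<close>

lemma real_polynomial_function_imp_poly_field:
  fixes f :: "real ^ 'i::finite \<Rightarrow> real"
  assumes "real_polynomial_function f"
  shows "\<exists>k. poly_field k f"
  using assms
proof (induction rule: real_polynomial_function.induct)
  case (linear f)
  then interpret bounded_linear f .
  have "f X = (\<Sum>i\<in>UNIV. mi_pow X (\<lambda>j. if j = i then 1 else 0) *\<^sub>R f (axis i 1))" for X
  proof -
    have "mi_pow X (\<lambda>j. if j = i then 1 else 0) = X $ i" for i
      by (simp add: mi_pow_def if_distrib cong: if_cong)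
    moreover have "X = (\<Sum>i\<in>UNIV. (X $ i) *\<^sub>R axis i 1)"
      by (metis basis_expansion scalar_mult_eq_scaleR)
    then have "f X = (\<Sum>i\<in>UNIV. (X $ i) *\<^sub>R f (axis i 1))"
      by (metis (no_types, lifting) sum scaleR sum.cong)
    ultimately show ?thesis
      by simp
  qed
  moreover have "poly_field 1 (\<lambda>X. \<Sum>i\<in>UNIV. mi_pow X (\<lambda>j. if j = i then 1 else 0) *\<^sub>R f (axis i 1))"
    by (intro poly_field_sum poly_field.monomial) (simp add: mi_size_def)
  ultimately show ?case
    by (metis (no_types, lifting) ext)
next
  case (const c)
  have "poly_field 0 (\<lambda>X :: real ^ 'i. mi_pow X (\<lambda>_. 0) *\<^sub>R c)"
    by (rule poly_field.monomial) (simp add: mi_size_def)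
  then show ?case
    by (auto simp: mi_pow_def)
next
  case (add f g)
  then obtain k l where "poly_field k f" "poly_field l g"
    by blast
  then have "poly_field (max k l) (\<lambda>X. f X + g X)"
    by (intro poly_field.add) (auto elim: poly_field_mono)
  then show ?case ..
next
  case (mult f g)
  then show ?case
    using poly_field_mult by blast
qed

lemma polynomial_function_imp_poly_field:
  fixes f :: "real ^ 'i::finite \<Rightarrow> 'b::euclidean_space"
  assumes "polynomial_function f"
  shows "\<exists>k. poly_field k f"
proof -
  have "real_polynomial_function ((\<lambda>u. u \<bullet> b) \<circ> f)" for b
    using assms bounded_linear_inner_left unfolding polynomial_function_def by blast
  then have "\<exists>k. poly_field k (\<lambda>X. f X \<bullet> b)" for b
    by (intro real_polynomial_function_imp_poly_field) (simp add: comp_def)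
  then obtain k where k: "\<And>b. poly_field (k b) (\<lambda>X. f X \<bullet> b)"
    by metis
  have "poly_field (\<Sum>b\<in>Basis. k b) (\<lambda>X. \<Sum>b\<in>Basis. (f X \<bullet> b) *\<^sub>R b)"
  proof (rule poly_field_sum)
    fix b :: 'b
    assume "b \<in> Basis"
    then have "k b \<le> (\<Sum>b\<in>Basis. k b)"
      by (intro member_le_sum) auto
    with k have "poly_field (\<Sum>b\<in>Basis. k b) (\<lambda>X. f X \<bullet> b)"
      by (rule poly_field_mono)
    then show "poly_field (\<Sum>b\<in>Basis. k b) (\<lambda>X. (f X \<bullet> b) *\<^sub>R b)"
      by (rule poly_field_linear[where T = "\<lambda>r. r *\<^sub>R b"]) (simp add: linear_iff scaleR_add_left)
  qed
  then show ?thesis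
    by (auto simp: euclidean_representation)
qed

lemma poly_field_homogeneous_parts:
  fixes f :: "real ^ 'i::finite \<Rightarrow> 'b::real_normed_vector"
  assumes "poly_field k f"
  shows "\<exists>h. (\<forall>X. f X = (\<Sum>j\<le>k. h j X)) \<and> (\<forall>j. poly_field j (h j)) \<and>
    (\<forall>j t X. h j (t *\<^sub>R X) = t ^ j *\<^sub>R h j X)"
  using assms
proof (induction rule: poly_field.induct)
  case zero
  show ?case
    by (rule exI[of _ "\<lambda>j X. 0"]) (simp add: poly_field.zero)
next
  case (monomial \<gamma> c)
  define h where "h j X = (if j = mi_size \<gamma> then mi_pow X \<gamma> *\<^sub>R c else 0)" for j and X :: "real ^ 'i"
  have "mi_pow (t *\<^sub>R X) \<gamma> = t ^ mi_size \<gamma> * mi_pow X \<gamma>" for t and X :: "real ^ 'i"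
    by (simp add: mi_pow_def mi_size_def power_mult_distrib prod.distrib power_sum)
  then have "h j (t *\<^sub>R X) = t ^ j *\<^sub>R h j X" for j t X
    by (simp add: h_def)
  moreover have "poly_field j (h j)" for j
  proof (cases "j = mi_size \<gamma>")
    case True
    then have "h j = (\<lambda>X. mi_pow X \<gamma> *\<^sub>R c)"
      by (simp add: h_def fun_eq_iff)
    then show ?thesis
      using True by (simp add: poly_field.monomial)
  next
    case False
    then have "h j = (\<lambda>X. 0)"
      by (simp add: h_def fun_eq_iff)
    then show ?thesis
      by (simp add: poly_field.zero)
  qed
  moreover have "mi_pow X \<gamma> *\<^sub>R c = (\<Sum>j\<le>k. h j X)" for X
    using monomial by (simp add: h_def)
  ultimately show ?case
    by blast
next
  case (add f g)
  then obtain h1 h2 where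
    "\<forall>X. f X = (\<Sum>j\<le>k. h1 j X)" "\<forall>j. poly_field j (h1 j)" "\<forall>j t X. h1 j (t *\<^sub>R X) = t ^ j *\<^sub>R h1 j X"
    "\<forall>X. g X = (\<Sum>j\<le>k. h2 j X)" "\<forall>j. poly_field j (h2 j)" "\<forall>j t X. h2 j (t *\<^sub>R X) = t ^ j *\<^sub>R h2 j X"
    by blast
  then show ?case
    by (intro exI[of _ "\<lambda>j X. h1 j X + h2 j X"])
      (simp add: sum.distrib scaleR_add_right poly_field.add)
qed

text \<open>
  The leading term of a polynomial in one real variable eventually dominates all the others, so it
  can be removed as long as its degree exceeds the order of growth.
\<close>

lemma coeff_eq_0_if_growth_le:
  fixes a :: "nat \<Rightarrow> 'b::real_normed_vector"
  assumes "\<And>t. t \<ge> 1 \<Longrightarrow> norm (\<Sum>j\<le>N. t ^ j *\<^sub>R a j) \<le> C * t ^ k" "k < j" "j \<le> N"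
  shows "a j = 0"
  using assms
proof (induction N)
  case 0
  then show ?case by simp
next
  case (Suc N)
  define K where "K = \<bar>C\<bar> + (\<Sum>j\<le>N. norm (a j))"
  \<comment> \<open>after division by \<open>t ^ N\<close> all other contributions are at most the constant \<open>K\<close>\<close>
  have lead: "a (Suc N) = 0"
  proof (rule ccontr)
    assume "a (Suc N) \<noteq> 0"
    have bound: "t * norm (a (Suc N)) \<le> K" if "t \<ge> 1" for t :: real
    proof -
      have "t ^ Suc N * norm (a (Suc N)) = norm (t ^ Suc N *\<^sub>R a (Suc N))"
        using that by simp
      also have "t ^ Suc N *\<^sub>R a (Suc N) = (\<Sum>j\<le>Suc N. t ^ j *\<^sub>R a j) - (\<Sum>j\<le>N. t ^ j *\<^sub>R a j)"
        by simp
      also have "norm \<dots> \<le> norm (\<Sum>j\<le>Suc N. t ^ j *\<^sub>R a j) + norm (\<Sum>j\<le>N. t ^ j *\<^sub>R a j)"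
        by (rule norm_triangle_ineq4)
      also have "norm (\<Sum>j\<le>Suc N. t ^ j *\<^sub>R a j) \<le> \<bar>C\<bar> * t ^ N"
      proof -
        have "norm (\<Sum>j\<le>Suc N. t ^ j *\<^sub>R a j) \<le> C * t ^ k"
          using Suc.prems(1) that by blast
        also have "\<dots> \<le> \<bar>C\<bar> * t ^ N"
          using that Suc.prems(2,3) by (intro mult_mono power_increasing) auto
        finally show ?thesis .
      qed
      also have "norm (\<Sum>j\<le>N. t ^ j *\<^sub>R a j) \<le> (\<Sum>j\<le>N. norm (a j) * t ^ N)"
      proof (rule sum_norm_le)
        fix j
        assume "j \<in> {..N}"
        then have "t ^ j \<le> t ^ N"
          using that by (intro power_increasing) auto
        then show "norm (t ^ j *\<^sub>R a j) \<le> norm (a j) * t ^ N"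
          using that by (simp add: mult.commute[of _ "t ^ N"] mult_right_mono)
      qed
      also have "\<bar>C\<bar> * t ^ N + (\<Sum>j\<le>N. norm (a j) * t ^ N) = K * t ^ N"
        by (simp add: K_def distrib_right sum_distrib_right)
      finally have "(t * norm (a (Suc N))) * t ^ N \<le> K * t ^ N"
        by (simp add: mult_ac)
      then show ?thesis
        using that by (simp add: mult_le_cancel_right)
    qed
    have "K \<ge> 0"
      by (simp add: K_def sum_nonneg)
    then have "K + norm (a (Suc N)) \<le> K"
      using bound[of "K / norm (a (Suc N)) + 1"] \<open>a (Suc N) \<noteq> 0\<close>
      by (simp add: distrib_right)
    then show False
      using \<open>a (Suc N) \<noteq> 0\<close> by simp
  qed
  show ?case
  proof (cases "j = Suc N")
    case True
    then show ?thesis using lead by simp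
  next
    case False
    then show ?thesis
      using Suc lead by simp
  qed
qed

text \<open>
  Along the ray through \<open>X\<close> the field is a polynomial in \<open>t\<close> whose coefficients are the homogeneous
  parts at \<open>X\<close>. Growth of order \<open>k\<close> makes the parts of degree above \<open>k\<close> vanish at \<open>X\<close>. Arguing with
  these parts as functions avoids the uniqueness of coefficients in several variables. The factor
  2 absorbs \<open>|x| + |y| \<le> 2 |X|\<close>.
\<close>

lemma poly_field_if_growth_le:
  fixes f :: "real ^ 'i::finite \<Rightarrow> 'b::euclidean_space"
  assumes "polynomial_function f" and growth: "\<And>X. norm (f X) \<le> C * (1 + 2 * norm X) ^ k"
  shows "poly_field k f"
proof -
  obtain N where "poly_field N f"
    using polynomial_function_imp_poly_field assms(1) by blast
  then obtain h where f: "\<And>X. f X = (\<Sum>j\<le>N. h j X)" and h: "\<And>j. poly_field j (h j)"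
    and hom: "\<And>j t X. h j (t *\<^sub>R X) = t ^ j *\<^sub>R h j X"
    using poly_field_homogeneous_parts by blast
  have h0: "h j X = 0" if "k < j" "j \<le> N" for j X
  proof (rule coeff_eq_0_if_growth_le[OF _ that])
    fix t :: real
    assume "t \<ge> 1"
    have "norm (\<Sum>j\<le>N. t ^ j *\<^sub>R h j X) = norm (f (t *\<^sub>R X))"
      by (simp add: f hom)
    also have "\<dots> \<le> C * (1 + 2 * norm (t *\<^sub>R X)) ^ k"
      by (rule growth)
    also have "\<dots> \<le> \<bar>C\<bar> * ((1 + 2 * norm X) * t) ^ k"
      using \<open>t \<ge> 1\<close> by (intro mult_mono power_mono) (auto simp: algebra_simps)
    finally show "norm (\<Sum>j\<le>N. t ^ j *\<^sub>R h j X) \<le> (\<bar>C\<bar> * (1 + 2 * norm X) ^ k) * t ^ k"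
      by (simp add: power_mult_distrib mult.assoc)
  qed
  have "f X = (\<Sum>j\<in>{..min k N}. h j X)" for X
    unfolding f by (rule sum.mono_neutral_right) (auto, metis h0 not_le)
  moreover have "poly_field k (\<lambda>X. \<Sum>j\<in>{..min k N}. h j X)"
    by (intro poly_field_sum) (auto intro: poly_field_mono[OF h])
  ultimately show ?thesis
    by presburger
qed


section \<open>Boundary layers and the recursion\<close>

lemma pt_hor_ver: "pt (hor X) (ver X) = X"
  by (simp add: vec_eq_iff pt_def hor_def split: option.split)

lemma norm_hor_le: "norm (hor X) \<le> norm X"
  unfolding norm_vec_def hor_def L2_set_def
  by (simp add: UNIV_option_conv sum.reindex)

lemma poly_field_boundary_layer:
  assumes "boundary_layer \<Omega> \<alpha> l i v q vp qp vh qh"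
  shows "poly_field (mi_size \<alpha>) vp"
proof -
  obtain C where C: "\<And>x y. norm (vp (pt x y)) \<le> C * (1 + norm x + \<bar>y\<bar>) ^ mi_size \<alpha>"
    using assms unfolding boundary_layer_def by blast
  have "norm (vp X) \<le> \<bar>C\<bar> * (1 + 2 * norm X) ^ mi_size \<alpha>" for X
  proof -
    have "norm (vp X) \<le> C * (1 + norm (hor X) + \<bar>ver X\<bar>) ^ mi_size \<alpha>"
      using C[of "hor X" "ver X"] by (simp add: pt_hor_ver)
    also have "\<dots> \<le> \<bar>C\<bar> * (1 + 2 * norm X) ^ mi_size \<alpha>"
      using norm_hor_le[of X] component_le_norm_cart[of X None]
      by (intro mult_mono power_mono) auto
    finally show ?thesis .
  qed
  moreover have "polynomial_function vp"
    using assms unfolding boundary_layer_def by blast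
  ultimately show ?thesis
    by (intro poly_field_if_growth_le)
qed

text \<open>
  For \<open>\<alpha> = 0\<close> the polynomial part has degree zero and is a constant, and the remaining part of the
  layer decays exponentially.
\<close>

lemma Tvec_eq:
  assumes "halfspace \<subseteq> \<Omega>"
    and "boundary_layer \<Omega> (\<lambda>_. 0) 1 i (v (\<lambda>_. 0) 1 i) q vp qp vh qh"
  shows "Tvec v i = vp X"
proof -
  have "\<exists>C. \<forall>x. \<forall>y\<ge>4. norm (vh (pt x y)) + \<bar>qh (pt x y)\<bar>
      \<le> C * (1 + norm x) ^ mi_size (\<lambda>_ :: 'a. 0) * exp (- y / 2)"
    using assms(2) unfolding boundary_layer_def by blast
  then obtain C where C: "\<And>x y. y \<ge> 4 \<Longrightarrow> norm (vh (pt x y)) + \<bar>qh (pt x y)\<bar> \<le> C * exp (- y / 2)"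
    by (auto simp: mi_size_def)
  have lim: "((\<lambda>y. v (\<lambda>_. 0) 1 i (pt x y)) \<longlongrightarrow> vp X) at_top" for x
  proof -
    have "((\<lambda>y. exp (- y / 2)) \<longlongrightarrow> (0 :: real)) at_top"
      by (rule filterlim_compose[OF exp_at_bot])
        (auto simp: filterlim_uminus_at_bot intro!: filterlim_tendsto_pos_mult_at_top[of "\<lambda>_. 1/2" "1/2", simplified]
          filterlim_ident)
    then have "((\<lambda>y. C * exp (- y / 2)) \<longlongrightarrow> 0) at_top"
      by (rule tendsto_mult_right_zero)
    then have vh: "((\<lambda>y. vh (pt x y)) \<longlongrightarrow> 0) at_top"
    proof (rule Lim_null_comparison[rotated])
      show "\<forall>\<^sub>F y in at_top. norm (vh (pt x y)) \<le> C * exp (- y / 2)"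
        using eventually_ge_at_top[of 4]
      proof eventually_elim
        case (elim y)
        then show ?case using C[of y x] by linarith
      qed
    qed
    have "\<forall>\<^sub>F y in at_top. v (\<lambda>_. 0) 1 i (pt x y) = vp X + vh (pt x y)"
      using eventually_gt_at_top[of 0]
    proof eventually_elim
      case (elim y)
      then have "pt x y \<in> \<Omega>"
        using assms(1) by (auto simp: pt_def)
      then have "v (\<lambda>_. 0) 1 i (pt x y) = vp (pt x y) + vh (pt x y)"
        using assms(2) unfolding boundary_layer_def by blast
      also have "vp (pt x y) = vp X"
        using poly_field_boundary_layer[OF assms(2)] by (intro poly_field_0_constant) (simp add: mi_size_def)
      finally show ?case .
    qed
    then show ?thesis
      using tendsto_add[OF tendsto_const[of "vp X"] vh] by (simp add: tendsto_cong)
  qed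
  show ?thesis
    unfolding Tvec_def
  proof (rule the_equality)
    fix T
    assume "\<forall>x. ((\<lambda>y. v (\<lambda>_. 0) 1 i (pt x y)) \<longlongrightarrow> T) at_top"
    then show "T = vp X"
      using lim tendsto_unique[OF trivial_limit_at_top_linorder] by blast
  qed (use lim in blast)
qed

lemma Wcol_eq: "Wcol vp \<alpha> l i = (\<lambda>X. mono_field \<alpha> l i X + vp \<alpha> l i X)"
  by (simp add: Wcol_def fun_eq_iff)

lemma smooth_on_UNIV_Wcol:
  assumes "smooth_on UNIV (vp \<alpha> l i)"
  shows "smooth_on UNIV (Wcol vp \<alpha> l i)"
  unfolding Wcol_eq mono_field_eq_mi_pow
  by (intro smooth_on_UNIV_add smooth_on_UNIV_monomial assms)

text \<open>
  The polynomial part of the layer has degree \<open>|\<alpha>| < |\<alpha>| + l\<close>, so that in the orders considered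
  here only the monomial \<open>x^\<alpha> y^l\<close> can contribute.
\<close>

lemma mderiv_Wcol_top:
  assumes "poly_field (mi_size \<alpha>) (vp \<alpha> l i)" "l \<ge> 1" "mi_size \<alpha> + l \<le> mi_size \<beta> + k"
  shows "mderiv \<beta> k (Wcol vp \<alpha> l i) X
    = (if (\<beta>, k) = (\<alpha>, l) then (mi_fact \<alpha> * fact l) *\<^sub>R axis i 1 else 0)"
proof -
  let ?js = "deriv_word \<beta> k"
  have "foldr pd ?js (vp \<alpha> l i) = (\<lambda>X. 0)"
    using assms by (intro foldr_pd_poly_field_eq_0) (auto simp: length_deriv_word)
  moreover have "foldr pd ?js (mono_field \<alpha> l i) X
      = (if (\<beta>, k) = (\<alpha>, l) then (mi_fact \<alpha> * fact l) *\<^sub>R axis i 1 else 0)"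
  proof (cases "(\<beta>, k) = (\<alpha>, l)")
    case True
    then show ?thesis
      by (simp add: mono_field_eq_mi_pow foldr_pd_monomial_same count_list_deriv_word mi_fact_joint_mi)
  next
    case False
    then have "joint_mi \<alpha> l \<noteq> joint_mi \<beta> k"
      by (auto simp: joint_mi_eq_iff)
    then show ?thesis
      using assms(3) False unfolding mono_field_eq_mi_pow
      by (subst foldr_pd_monomial_eq_0)
        (auto simp: count_list_deriv_word mi_size_joint_mi length_deriv_word)
  qed
  moreover have "foldr pd ?js (\<lambda>X. mono_field \<alpha> l i X + vp \<alpha> l i X)
      = (\<lambda>X. foldr pd ?js (mono_field \<alpha> l i) X + foldr pd ?js (vp \<alpha> l i) X)"
    using smooth_on_UNIV_poly_field[OF assms(1)]
    by (intro foldr_pd_add) (simp_all add: mono_field_eq_mi_pow smooth_on_UNIV_monomial)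
  ultimately show ?thesis
    by (simp add: mderiv_eq_foldr_pd Wcol_eq)
qed

text \<open>
  Taking a column is a bounded linear map, so it commutes with derivatives. The recursion for \<open>\<Phi>\<close>,
  which is stated for matrices, can therefore be read column by column.
\<close>

lemma mderiv_Wmat_column:
  fixes vp :: "('n::finite, real ^ ('n option)) layers"
  assumes "\<And>i. smooth_on UNIV (vp \<alpha> l i)"
  shows "mderiv \<beta> k (Wmat vp \<alpha> l) X *v axis i 1 = mderiv \<beta> k (Wcol vp \<alpha> l i) X"
proof -
  \<comment> \<open>the matrix is assembled from its columns by the linear maps \<open>E c\<close>, and inherits their smoothness\<close>
  define E :: "'n option \<Rightarrow> real ^ ('n option) \<Rightarrow> real ^ ('n option) ^ ('n option)"
    where "E c u = (\<chi> r c'. if c' = c then u $ r else 0)" for c u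
  have E: "bounded_linear (E c)" for c
    unfolding linear_conv_bounded_linear[symmetric]
    by (rule linearI) (simp_all add: E_def vec_eq_iff)
  have "Wmat vp \<alpha> l = (\<lambda>X. \<Sum>c\<in>UNIV. E c (Wcol vp \<alpha> l c X))"
    by (simp add: fun_eq_iff vec_eq_iff Wmat_def E_def)
  moreover have "smooth_on UNIV (Wcol vp \<alpha> l c)" for c
    using assms by (rule smooth_on_UNIV_Wcol)
  ultimately have sm: "smooth_on UNIV (Wmat vp \<alpha> l)"
    by (simp add: smooth_on_UNIV_sum smooth_on_UNIV_bounded_linear[OF _ E])
  have col: "bounded_linear (\<lambda>M :: real ^ ('n option) ^ ('n option). M *v axis i 1)"
    unfolding linear_conv_bounded_linear[symmetric]
    by (rule linearI) (simp_all add: matrix_vector_mult_add_rdistrib scaleR_matrix_vector_assoc)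
  have "Wcol vp \<alpha> l i = (\<lambda>X. Wmat vp \<alpha> l X *v axis i 1)"
    by (simp add: fun_eq_iff vec_eq_iff matrix_vector_mult_basis column_def Wmat_def)
  then show ?thesis
    by (simp add: mderiv_eq_foldr_pd foldr_pd_bounded_linear[OF sm col])
qed

text \<open>
  The terms of order at least \<open>n = |\<alpha>| + l\<close> collapse to \<open>\<alpha>! l! \<Phi>^{\<alpha>,l} e_i\<close>. By the recursion this is
  \<open>W(x,0)\<close> minus the terms of order below \<open>n\<close>. The recursion starts at \<open>n = 2\<close>, so for \<open>n = 1\<close> the
  equality has to be supplied in the form of the hypothesis \<open>base\<close>.
\<close>

lemma Wcol_eq_sum_Phi:
  fixes vp :: "('n::finite, real ^ ('n option)) layers"
  assumes deg: "\<And>i. poly_field (mi_size \<alpha>) (vp \<alpha> l i)"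
    and al: "(\<alpha>, l) \<in> idx_le m"
    and base: "mi_size \<alpha> + l = 1 \<Longrightarrow> Phi01 v *v axis i 1 = vp \<alpha> l i (pt x 0)"
  shows "Wcol vp \<alpha> l i (pt x 0)
    = (\<Sum>(\<beta>, k)\<in>idx_le m. Phi v vp \<beta> k x *v mderiv \<beta> k (Wcol vp \<alpha> l i) (pt x 0))"
proof -
  define n where "n = mi_size \<alpha> + l"
  define g where "g = (\<lambda>(\<beta>, k). Phi v vp \<beta> k x *v mderiv \<beta> k (Wcol vp \<alpha> l i) (pt x 0))"
  have l: "l \<ge> 1" and nm: "n \<le> m"
    using al by (auto simp: idx_le_def n_def)
  have pos: "mi_fact \<alpha> * fact l \<noteq> 0"
    by (simp add: mi_fact_def)
  have top: "Phi v vp \<alpha> l x *v mderiv \<alpha> l (Wcol vp \<alpha> l i) (pt x 0)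
      = (mi_fact \<alpha> * fact l) *\<^sub>R (Phi v vp \<alpha> l x *v axis i 1)"
    using mderiv_Wcol_top[of \<alpha> vp l i \<alpha> l, OF deg l]
    by (simp add: matrix_vector_mult_scaleR)
  \<comment> \<open>for \<open>n = 1\<close> the sum over \<open>idx_le (n - 1)\<close> is empty, since \<open>idx_le\<close> requires \<open>k \<ge> 1\<close>\<close>
  have recursion: "(mi_fact \<alpha> * fact l) *\<^sub>R (Phi v vp \<alpha> l x *v axis i 1)
      = Wcol vp \<alpha> l i (pt x 0) - sum g (idx_le (n - 1))"
  proof (cases "n = 1")
    case True
    then have "l = 1" "mi_size \<alpha> = 0"
      using l by (auto simp: n_def)
    then have "mi_fact \<alpha> = 1"
      by (simp add: mi_size_def mi_fact_def)
    moreover have "idx_le (n - 1) = ({} :: (('n \<Rightarrow> nat) \<times> nat) set)"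
      using True by (auto simp: idx_le_def)
    moreover have "mono_field \<alpha> l i (pt x 0) = 0"
      using \<open>l = 1\<close> by (simp add: mono_field_def pt_def)
    ultimately show ?thesis
      using base True \<open>l = 1\<close> \<open>mi_size \<alpha> = 0\<close> by (simp add: Phi.simps[of v vp \<alpha>] Wcol_def)
  next
    case False
    have col: "(\<Sum>(\<beta>, k)\<in>idx_le (n - 1). Phi v vp \<beta> k x ** mderiv \<beta> k (Wmat vp \<alpha> l) (pt x 0)) *v axis i 1
        = sum g (idx_le (n - 1))"
    proof -
      have lin: "linear (\<lambda>M :: real ^ ('n option) ^ ('n option). M *v axis i 1)"
        by (rule linearI) (simp_all add: matrix_vector_mult_add_rdistrib scaleR_matrix_vector_assoc)
      show ?thesis
        unfolding linear_sum[OF lin] g_def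
        by (intro sum.cong)
          (auto simp: matrix_vector_mul_assoc[symmetric] mderiv_Wmat_column smooth_on_UNIV_poly_field[OF deg])
    qed
    have "Wmat vp \<alpha> l (pt x 0) *v axis i 1 = Wcol vp \<alpha> l i (pt x 0)"
      by (simp add: vec_eq_iff matrix_vector_mult_basis column_def Wmat_def)
    moreover have "(mi_fact \<alpha> * fact l) *\<^sub>R Phi v vp \<alpha> l x = Wmat vp \<alpha> l (pt x 0)
        - (\<Sum>(\<beta>, k)\<in>idx_le (n - 1). Phi v vp \<beta> k x ** mderiv \<beta> k (Wmat vp \<alpha> l) (pt x 0))"
      using False l pos by (subst Phi.simps) (auto simp: n_def)
    ultimately show ?thesis
      using col by (simp add: matrix_vector_mult_diff_rdistrib scaleR_matrix_vector_assoc)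
  qed
  have "sum g (idx_le m) = sum g (insert (\<alpha>, l) (idx_le (n - 1)))"
  proof (rule sum.mono_neutral_right[OF finite_idx_le])
    show "insert (\<alpha>, l) (idx_le (n - 1)) \<subseteq> idx_le m"
      using al nm by (auto simp: idx_le_def)
    show "\<forall>p\<in>idx_le m - insert (\<alpha>, l) (idx_le (n - 1)). g p = 0"
    proof
      fix p
      assume p: "p \<in> idx_le m - insert (\<alpha>, l) (idx_le (n - 1))"
      obtain \<beta> k where "p = (\<beta>, k)"
        by (cases p)
      with p have "(\<beta>, k) \<noteq> (\<alpha>, l)" "mi_size \<alpha> + l \<le> mi_size \<beta> + k"
        by (auto simp: idx_le_def n_def)
      then show "g p = 0"
        using mderiv_Wcol_top[of \<alpha> vp l i \<beta> k, OF deg l] \<open>p = (\<beta>, k)\<close>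
        by (auto simp: g_def)
    qed
  qed
  also have "\<dots> = g (\<alpha>, l) + sum g (idx_le (n - 1))"
    using l by (subst sum.insert[OF finite_idx_le]) (auto simp: idx_le_def n_def)
  also have "\<dots> = Wcol vp \<alpha> l i (pt x 0)"
    using top recursion by (simp add: g_def)
  finally show ?thesis
    by (simp add: g_def)
qed


section \<open>The solenoidal constraint and the effective boundary condition\<close>

text \<open>
  At the origin, the only field \<open>x^\<alpha> y^l e_i\<close> with \<open>l \<ge> 1\<close> that has nonzero divergence is \<open>y e_d\<close>: the
  derivative of a monomial with respect to coordinate \<open>j\<close> is nonzero there only if the monomial is
  the coordinate itself. The divergence of \<open>P\<close> vanishes in the open half-space, hence by continuity
  also at the origin.
\<close>

lemma solenoidal_coeff_eq_0:
  fixes P :: "real ^ ('n::finite option) \<Rightarrow> real ^ ('n option)"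
  assumes P: "P = (\<lambda>X. \<Sum>(\<alpha>, l)\<in>idx_le m. \<Sum>i\<in>UNIV. A \<alpha> l i *\<^sub>R mono_field \<alpha> l i X)"
    and dvg: "\<And>X. X \<in> halfspace \<Longrightarrow> dvg P X = 0"
    and "m \<ge> 1"
  shows "A (\<lambda>_. 0) 1 None = 0"
proof -
  define M where "M p i = (\<lambda>X. mi_pow X (joint_mi (fst p) (snd p)) *\<^sub>R
      (A (fst p) (snd p) i *\<^sub>R (axis i 1 :: real ^ ('n option))))" for p i
  have smM: "smooth_on UNIV (M p i)" for p i
    unfolding M_def by (rule smooth_on_UNIV_monomial)
  have smS: "smooth_on UNIV (\<lambda>X. \<Sum>i\<in>UNIV. M p i X)" for p
    by (intro smooth_on_UNIV_sum smM)
  have P': "P = (\<lambda>X. \<Sum>p\<in>idx_le m. \<Sum>i\<in>UNIV. M p i X)"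
    by (simp add: P M_def mono_field_eq_mi_pow split_beta mult.commute)
  have sm: "smooth_on UNIV P"
    unfolding P' by (intro smooth_on_UNIV_sum smM)
  have cont: "isCont (dvg P) 0"
  proof -
    have "isCont (pd j P) 0" for j
      using smooth_on_UNIV_D[OF sm, of "[j]"] by (simp add: differentiable_imp_continuous_within)
    then show ?thesis
      unfolding dvg_def trace_def grad_def by (simp add: continuous_intros)
  qed
  have at0: "dvg P 0 = 0"
  proof -
    have "((\<lambda>t. t *\<^sub>R axis None 1 :: real ^ ('n option)) \<longlongrightarrow> 0) (at_right 0)"
      by (auto intro!: tendsto_eq_intros)
    then have "((\<lambda>t. dvg P (t *\<^sub>R axis None 1)) \<longlongrightarrow> dvg P 0) (at_right 0)"
      by (rule isCont_tendsto_compose[OF cont])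
    moreover have "\<forall>\<^sub>F t in at_right 0. dvg P (t *\<^sub>R axis None 1) = 0"
      using eventually_at_right_less[of 0]
      by eventually_elim (auto intro!: dvg simp: axis_def)
    then have "((\<lambda>t. dvg P (t *\<^sub>R axis None 1)) \<longlongrightarrow> 0) (at_right 0)"
      by (rule tendsto_eventually)
    ultimately show ?thesis
      by (rule tendsto_unique[OF trivial_limit_at_right_real])
  qed
  have "dvg P 0 = A (\<lambda>_. 0) 1 None"
  proof -
    have pdP: "pd j P 0 $ j = (if j = None then A (\<lambda>_. 0) 1 None else 0)" for j
    proof -
      have pdM: "pd j (M p i) 0 $ j
          = (if p = (\<lambda>_. 0, 1) then if i = None \<and> j = None then A (\<lambda>_. 0) 1 None else 0 else 0)"
        if "p \<in> idx_le m" for p i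
      proof -
        obtain \<alpha> l where p: "p = (\<alpha>, l)"
          by (cases p)
        have l: "l \<ge> 1"
          using that by (simp add: p idx_le_def)
        let ?\<gamma> = "(joint_mi \<alpha> l)(j := joint_mi \<alpha> l j - 1)"
        have "pd j (M p i) 0 $ j
            = mi_pow 0 ?\<gamma> * (real (joint_mi \<alpha> l j) * (A \<alpha> l i * axis i 1 $ j))"
          by (simp only: p fst_conv snd_conv M_def pd_monomial vector_scaleR_component real_scaleR_def)
        moreover have "mi_pow (0 :: real ^ ('n option)) \<delta> = (if \<delta> = (\<lambda>_. 0) then 1 else 0)" for \<delta>
        proof (cases "\<delta> = (\<lambda>_. 0)")
          case False
          then obtain r where "\<delta> r \<noteq> 0" by auto
          then show ?thesis
            using False unfolding mi_pow_def by (auto intro!: prod_zero)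
        qed (simp add: mi_pow_def)
        moreover have "?\<gamma> = (\<lambda>_. 0) \<longleftrightarrow> j = None \<and> (\<alpha>, l) = (\<lambda>_. 0, 1)"
        proof
          assume "?\<gamma> = (\<lambda>_. 0)"
          then have *: "?\<gamma> r = 0" for r by simp
          have "j = None" using *[of None] l by (cases j) auto
          moreover have "\<alpha> r = 0" for r using *[of "Some r"] \<open>j = None\<close> by simp
          moreover have "l = 1" using *[of None] l \<open>j = None\<close> by simp
          ultimately show "j = None \<and> (\<alpha>, l) = (\<lambda>_. 0, 1)" by auto
        qed (auto simp: fun_eq_iff joint_mi_def split: option.split)
        ultimately have "pd j (M p i) 0 $ j = (if j = None \<and> (\<alpha>, l) = (\<lambda>_. 0, 1) then 1 else 0) *
            (real (joint_mi \<alpha> l j) * (A \<alpha> l i * axis i 1 $ j))"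
          by presburger
        then show ?thesis
          by (auto simp: p axis_def)
      qed
      have "pd j P = (\<lambda>X. \<Sum>p\<in>idx_le m. \<Sum>i\<in>UNIV. pd j (M p i) X)"
        using foldr_pd_sum[of "idx_le m" "\<lambda>p X. \<Sum>i\<in>UNIV. M p i X" "[j]", OF smS]
          foldr_pd_sum[of UNIV "M p" "[j]" for p, OF smM]
        by (simp add: P')
      then have "pd j P 0 $ j = (\<Sum>p\<in>idx_le m. \<Sum>i\<in>UNIV. pd j (M p i) 0 $ j)"
        by simp
      also have "\<dots> = (\<Sum>p\<in>(idx_le m :: (('n \<Rightarrow> nat) \<times> nat) set).
          if p = (\<lambda>_. 0, 1) then if j = None then A (\<lambda>_. 0) 1 None else 0 else 0)"
      proof (rule sum.cong[OF refl])
        fix p :: "('n \<Rightarrow> nat) \<times> nat"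
        assume p: "p \<in> idx_le m"
        have "(\<Sum>i\<in>UNIV. pd j (M p i) 0 $ j) = (\<Sum>i\<in>(UNIV :: 'n option set). if i = None then
            if p = (\<lambda>_. 0, 1) then if j = None then A (\<lambda>_. 0) 1 None else 0 else 0 else 0)"
          unfolding pdM[OF p] by (rule sum.cong) auto
        then show "(\<Sum>i\<in>UNIV. pd j (M p i) 0 $ j)
            = (if p = (\<lambda>_. 0, 1) then if j = None then A (\<lambda>_. 0) 1 None else 0 else 0)"
          by simp
      qed
      also have "\<dots> = (if j = None then A (\<lambda>_. 0) 1 None else 0)"
        using \<open>m \<ge> 1\<close> by (subst sum.delta[OF finite_idx_le]) (simp add: idx_le_def mi_size_def)
      finally show ?thesis .
    qed
    show ?thesis
      unfolding dvg_def trace_def grad_def by (simp add: pdP)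
  qed
  with at0 show ?thesis
    by simp
qed

theorem proposition5p2:
  fixes \<Omega> :: "(real ^ ('n::finite option)) set"
    and v vp vh :: "('n, real ^ ('n option)) layers"
    and q qp qh :: "('n, real) layers"
    and w :: "real ^ ('n option) \<Rightarrow> real ^ ('n option)"
    and \<pi> :: "real ^ ('n option) \<Rightarrow> real"
    and m :: nat
    and x :: "real ^ 'n"
  assumes "periodic_bumpy_john_domain \<Omega>"
    and "\<And>\<alpha> l i. l \<ge> 1 \<Longrightarrow>
      boundary_layer \<Omega> \<alpha> l i (v \<alpha> l i) (q \<alpha> l i) (vp \<alpha> l i) (qp \<alpha> l i) (vh \<alpha> l i) (qh \<alpha> l i)"
    and "m \<ge> 1"
    and "(w, \<pi>) \<in> stokes_eff vp qp m"
  shows "w (pt x 0) = (\<Sum>(\<alpha>, l)\<in>idx_le m. Phi v vp \<alpha> l x *v mderiv \<alpha> l w (pt x 0))"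
proof -
  have half: "halfspace \<subseteq> \<Omega>"
    using assms(1) by (simp add: periodic_bumpy_john_domain_def)
  have deg: "poly_field (mi_size \<alpha>) (vp \<alpha> l i)" if "l \<ge> 1" for \<alpha> l i
    using poly_field_boundary_layer assms(2) that by blast
  obtain P Q A where PQ: "(P, Q) \<in> stokes_poly m"
    and P: "P = (\<lambda>X. \<Sum>(\<alpha>, l)\<in>idx_le m. \<Sum>i\<in>UNIV. A \<alpha> l i *\<^sub>R mono_field \<alpha> l i X)"
    and w: "w = (\<lambda>X. \<Sum>(\<alpha>, l)\<in>idx_le m. \<Sum>i\<in>UNIV. A \<alpha> l i *\<^sub>R Wcol vp \<alpha> l i X)"
    using assms(4) by (auto simp: stokes_eff_def)
  have A0: "A (\<lambda>_. 0) 1 None = 0"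
    using PQ by (intro solenoidal_coeff_eq_0[OF P _ assms(3)]) (auto simp: stokes_poly_def)
  let ?g = "\<lambda>p f. Phi v vp (fst p) (snd p) x *v mderiv (fst p) (snd p) f (pt x 0)"
  \<comment> \<open>the zero coefficient of \<open>y e_d\<close> excludes the one field for which the identity may fail\<close>
  have W: "A \<alpha> l i *\<^sub>R Wcol vp \<alpha> l i (pt x 0)
      = A \<alpha> l i *\<^sub>R (\<Sum>p\<in>idx_le m. ?g p (Wcol vp \<alpha> l i))" if al: "(\<alpha>, l) \<in> idx_le m" for \<alpha> l i
  proof (cases "A \<alpha> l i = 0")
    case False
    have l: "l \<ge> 1"
      using al by (simp add: idx_le_def)
    have "Phi01 v *v axis i 1 = vp \<alpha> l i (pt x 0)" if "mi_size \<alpha> + l = 1"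
    proof -
      have "l = 1" "mi_size \<alpha> = 0"
        using l that by auto
      then have \<alpha>: "\<alpha> = (\<lambda>_. 0)"
        by (auto simp: mi_size_def)
      then have "i \<noteq> None"
        using False A0 \<open>l = 1\<close> by metis
      then have "Phi01 v *v axis i 1 = Tvec v i"
        by (auto simp: vec_eq_iff matrix_vector_mult_basis column_def Phi01_def)
      also have "\<dots> = vp (\<lambda>_. 0) 1 i (pt x 0)"
        by (rule Tvec_eq[where v = v, OF half assms(2)[of 1 "\<lambda>_. 0" i, OF order_refl]])
      finally show ?thesis
        using \<alpha> \<open>l = 1\<close> by simp
    qed
    from Wcol_eq_sum_Phi[of \<alpha> vp l m v i x, OF deg[OF l] al this] show ?thesis
      by (simp add: split_beta)
  qed simp
  have dw: "mderiv \<beta> k w (pt x 0)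
      = (\<Sum>p\<in>idx_le m. \<Sum>i\<in>UNIV. A (fst p) (snd p) i *\<^sub>R mderiv \<beta> k (Wcol vp (fst p) (snd p) i) (pt x 0))"
    for \<beta> k
  proof -
    have sW: "smooth_on UNIV (Wcol vp (fst p) (snd p) i)" if "p \<in> idx_le m" for p i
      using that by (intro smooth_on_UNIV_Wcol smooth_on_UNIV_poly_field[OF deg]) (auto simp: idx_le_def)
    have lin: "bounded_linear (\<lambda>u :: real ^ ('n option). a *\<^sub>R u)" for a
      by (rule bounded_linear_scaleR_right)
    have sAW: "smooth_on UNIV (\<lambda>X. A (fst p) (snd p) i *\<^sub>R Wcol vp (fst p) (snd p) i X)"
      if "p \<in> idx_le m" for p i
      using that sW by (intro smooth_on_UNIV_bounded_linear[OF _ lin])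
    show ?thesis
      unfolding w mderiv_eq_foldr_pd split_beta
      by (simp add: foldr_pd_sum smooth_on_UNIV_sum sAW foldr_pd_bounded_linear[OF sW lin])
  qed
  have "w (pt x 0) = (\<Sum>p\<in>idx_le m. \<Sum>i\<in>UNIV. A (fst p) (snd p) i *\<^sub>R
      (\<Sum>p'\<in>idx_le m. ?g p' (Wcol vp (fst p) (snd p) i)))"
    unfolding w split_beta by (intro sum.cong refl) (simp add: W)
  also have "\<dots> = (\<Sum>p\<in>idx_le m. \<Sum>p'\<in>idx_le m. \<Sum>i\<in>UNIV. A (fst p) (snd p) i *\<^sub>R
      ?g p' (Wcol vp (fst p) (snd p) i))"
    by (intro sum.cong refl) (subst sum.swap, simp add: scaleR_sum_right)
  also have "\<dots> = (\<Sum>p'\<in>idx_le m. \<Sum>p\<in>idx_le m. \<Sum>i\<in>UNIV. A (fst p) (snd p) i *\<^sub>R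
      ?g p' (Wcol vp (fst p) (snd p) i))"
    by (rule sum.swap)
  also have "\<dots> = (\<Sum>p\<in>idx_le m. ?g p w)"
    by (simp add: dw matrix_vector_right_distrib linear_sum[OF matrix_vector_mul_linear] matrix_vector_mult_scaleR)
  finally show ?thesis
    by (simp add: split_beta)
qed

end
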